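(* Let $f:\operatorname{dom}(f)\subseteq\mathbb{R}^n\to\mathbb{R}$ be $\mathcal{C}^3$ on the open ball $B(x^0,\overline{\Delta})$, and denote by $L$ the Lipschitz constant of $\nabla^2 f$. Let $f(x^0)\ne0$ whenever $k-1<0$. Let $\mathcal{X}=\langle x^0,x^1,\ldots,x^m\rangle$ be an ordered set of distinct points with radius $\Delta<\overline{\Delta}$ such that $S=S(\mathcal{X})$ has full rank. Let $\mathbb{U}=\operatorname{span}S$, $\widehat{S}=S/\Delta$ and $k\in\mathbb{R}$. Then $$\|\nabla^{cc}(f^k)(\mathcal{X})-\nabla(f^k)_{\mathbb{U}}(x^0)\|\le\frac{L\sqrt{m}}{6}\,|k|\,|f(x^0)|^{k-1}\,\big\|(\widehat{S}^\top)^\dagger\big\|\Delta^2.$$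
   Context: Vectors carry the Euclidean norm and matrices the induced operator norm; $A^\dagger$ is the Moore--Penrose pseudoinverse. For $\mathcal{X}=\langle x^0,x^1,\ldots,x^m\rangle\subset\mathbb{R}^n$ write $x^i=x^0+d^i$; the radius is $\Delta=\max_{i\in\{1,\ldots,m\}}\|d^i\|$ and $S(\mathcal{X})=[d^1\ \cdots\ d^m]\in\mathbb{R}^{n\times m}$. Full rank means $\operatorname{rank}S=\min\{m,n\}$; $\operatorname{span}S$ is the column span. The generalized centred simplex gradient of $f$ over $\mathcal{X}$ is $\nabla^c f(\mathcal{X})=(S^\top)^\dagger\delta^c_f(\mathcal{X})$, where $\delta^c_f(\mathcal{X})\in\mathbb{R}^m$ has $i$-th entry $\tfrac12\big(f(x^0+d^i)-f(x^0-d^i)\big)$. The generalized centred simplex calculus gradient of $f^k$ over $\mathcal{X}$ is defined as $\nabla^{cc}f^k(\mathcal{X})=k f^{k-1}(x^0)\nabla^c f(\mathcal{X})$, where $f(x^0)$ is nonzero whenever $k-1<0$. For a function $h$, $h_{\mathbb{U}}(y)=h\big(x^0+\operatorname{Proj}_{\mathbb{U}}(y-x^0)\big)$ with $\operatorname{Proj}_{\mathbb{U}}$ the orthogonal projection onto $\mathbb{U}$; $(f^k)_{\mathbb{U}}$ is this construction applied to $h=f^k$. If $S$ has full row rank, then $\mathbb{U}=\mathbb{R}^n$ and $h_{\mathbb{U}}=h$. The Lipschitz constant $L$ refers to $\nabla^2 f$ on $B(x^0,\overline{\Delta})$.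
   Formalization: For arbitrary real k the power f^k need not be real-valued (e.g. f = −1, k = 1/2), so it is additionally assumed that (f^k)_U is defined as a real power near x^0: base positive, or zero with k ≥ 0, or negative with k rational of odd denominator. *)

theory Defs
  imports "HOL-Analysis.Analysis"
begin

section \<open>Real powers\<close>

text \<open>
  The real power \<open>x\<^sup>k\<close>, wherever it is a real number: for all \<open>k\<close> if \<open>x > 0\<close>, for \<open>k \<ge> 0\<close> if \<open>x = 0\<close>
  (with \<open>0\<^sup>0 = 1\<close>), and for \<open>k = p/q\<close> with \<open>q\<close> odd, in particular for integers \<open>k\<close>, if \<open>x < 0\<close>.
  The operator \<open>powr\<close> does not serve here, since \<open>0 powr 0 = 0\<close> and \<open>(- x) powr k = x powr k\<close>.
  If \<open>q\<close> is odd, the parity of \<open>p\<close> depends only on \<open>p/q\<close>, so the sign for \<open>x < 0\<close> is well defined.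
\<close>

definition rpow_defined :: "real \<Rightarrow> real \<Rightarrow> bool"
  where "rpow_defined x k \<longleftrightarrow>
    x > 0 \<or> (x = 0 \<and> k \<ge> 0) \<or> (x < 0 \<and> (\<exists>p q::int. odd q \<and> k = of_int p / of_int q))"

definition rpow :: "real \<Rightarrow> real \<Rightarrow> real"
  where "rpow x k =
    (if x > 0 then x powr k
     else if x = 0 then (if k = 0 then 1 else 0)
     else if \<exists>p q::int. odd p \<and> odd q \<and> k = of_int p / of_int q then - (\<bar>x\<bar> powr k)
     else \<bar>x\<bar> powr k)"

lemma odd_ratio_parity:
  fixes p q p' q' :: int
  assumes "odd q" "odd q'" and "real_of_int p / of_int q = of_int p' / of_int q'"
  shows "odd p \<longleftrightarrow> odd p'"
proof -
  have "q \<noteq> 0" "q' \<noteq> 0" using assms by auto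
  then have "real_of_int (p * q') = real_of_int (p' * q)"
    using assms(3) by (simp add: field_simps)
  then have "p * q' = p' * q" by linarith
  then show ?thesis by (metis assms(1,2) even_mult_iff)
qed

lemma rpow_neg_ratio:
  fixes p q :: int
  assumes "x < 0" "odd q"
  shows "rpow x (of_int p / of_int q) =
    (if even p then 1 else -1) * \<bar>x\<bar> powr (of_int p / of_int q)"
proof -
  have "(\<exists>p' q'::int. odd p' \<and> odd q' \<and>
      real_of_int p / real_of_int q = of_int p' / of_int q') \<longleftrightarrow> odd p"
    using odd_ratio_parity[OF assms(2)] assms(2) by blast
  with assms(1) show ?thesis by (simp add: rpow_def)
qed

lemma rpow_of_int:
  assumes "rpow_defined x (of_int n)"
  shows "rpow x (of_int n) = x powi n"
proof -
  consider "x > 0" | "x = 0" "n \<ge> 0" | "x < 0"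
    using assms by (auto simp: rpow_defined_def)
  then show ?thesis
  proof cases
    case 1
    then show ?thesis by (simp add: rpow_def powr_real_of_int')
  next
    case 2
    then show ?thesis by (simp add: rpow_def power_int_0_left_if)
  next
    case 3
    then have "\<bar>x\<bar> powr of_int n = (- x) powi n" by (simp add: powr_real_of_int')
    moreover have "rpow x (of_int n) = (if even n then 1 else -1) * \<bar>x\<bar> powr of_int n"
      using rpow_neg_ratio[OF 3, of 1 n] by simp
    ultimately show ?thesis by (simp add: power_int_minus_left)
  qed
qed

lemma rpow_odd_root:
  assumes "odd q"
  shows "rpow x (1 / real q) = root q x"
proof -
  have q: "q > 0" using assms by (auto intro: Nat.gr0I)
  consider "x > 0" | "x = 0" | "x < 0" by linarith
  then show ?thesis
  proof cases
    case 1
    then show ?thesis using q by (simp add: rpow_def root_powr_inverse)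
  next
    case 2
    then show ?thesis using q by (simp add: rpow_def)
  next
    case 3
    have "rpow x (1 / real q) = - (\<bar>x\<bar> powr (1 / real q))"
      using rpow_neg_ratio[OF 3, of "int q" 1] assms by simp
    also have "\<dots> = - root q (- x)" using q 3 by (simp add: root_powr_inverse)
    also have "\<dots> = root q x" by (simp add: real_root_minus)
    finally show ?thesis .
  qed
qed

section \<open>Differential calculus\<close>

text \<open>\<open>Ck_on n f U\<close> is the usual notion of \<open>f\<close> being \<open>C\<^sup>n\<close> on \<open>U\<close> for \<open>U\<close> open.\<close>

primrec Ck_on ::
    "nat \<Rightarrow> ('a::real_normed_vector \<Rightarrow> 'b::real_normed_vector) \<Rightarrow> 'a set \<Rightarrow> bool"
  where
    "Ck_on 0 f U \<longleftrightarrow> continuous_on U f"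
  | "Ck_on (Suc n) f U \<longleftrightarrow>
      (\<forall>x\<in>U. f differentiable (at x)) \<and> (\<forall>v. Ck_on n (\<lambda>x. frechet_derivative f (at x) v) U)"

definition gradient :: "('a::real_inner \<Rightarrow> real) \<Rightarrow> 'a \<Rightarrow> 'a"
  where "gradient f x = (THE D. GDERIV f x :> D)"

lemma gradient_eq:
  assumes "GDERIV f x :> D"
  shows "gradient f x = D"
  unfolding gradient_def
proof (rule the_equality)
  show "GDERIV f x :> D" by (fact assms)
next
  fix E assume "GDERIV f x :> E"
  then have "(\<lambda>h. inner h E) = (\<lambda>h. inner h D)"
    using assms unfolding gderiv_def by (rule has_derivative_unique)
  then have "\<forall>h. inner h E = inner h D" by (simp add: fun_eq_iff)
  then show "E = D" by (simp only: vector_eq_ldot)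
qed

definition hessian :: "(real^'n \<Rightarrow> real) \<Rightarrow> real^'n \<Rightarrow> real^'n^'n"
  where "hessian f x = matrix (frechet_derivative (gradient f) (at x))"

section \<open>Matrices and projections\<close>

definition opnorm :: "real^'n^'m \<Rightarrow> real"
  where "opnorm A = onorm (\<lambda>v. A *v v)"

definition pinv :: "real^'n^'m \<Rightarrow> real^'m^'n"
  where "pinv A = (THE B. A ** B ** A = A \<and> B ** A ** B = B \<and>
    transpose (A ** B) = A ** B \<and> transpose (B ** A) = B ** A)"

definition orth_proj :: "'a::real_inner set \<Rightarrow> 'a \<Rightarrow> 'a"
  where "orth_proj U v = (THE p. p \<in> U \<and> (\<forall>u\<in>U. inner (v - p) u = 0))"

definition restr_to :: "'a::real_inner set \<Rightarrow> 'a \<Rightarrow> ('a \<Rightarrow> real) \<Rightarrow> 'a \<Rightarrow> real"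
  where "restr_to U x0 h y = h (x0 + orth_proj U (y - x0))"

section \<open>Simplex gradients\<close>

text \<open>
  The ordered set \<open>\<langle>x\<^sup>0, x\<^sup>1, \<dots>, x\<^sup>m\<rangle>\<close> is given by \<open>x0\<close> and a family \<open>x\<close>
  indexed by a finite type \<open>'m\<close>, so that \<open>m = CARD('m)\<close>.
\<close>

definition radius :: "real^'n \<Rightarrow> ('m::finite \<Rightarrow> real^'n) \<Rightarrow> real"
  where "radius x0 x = Max (range (\<lambda>i. norm (x i - x0)))"

definition Smat :: "real^'n \<Rightarrow> ('m::finite \<Rightarrow> real^'n) \<Rightarrow> real^'m^'n"
  where "Smat x0 x = (\<chi> j i. (x i - x0) $ j)"

definition delta_c ::
    "(real^'n \<Rightarrow> real) \<Rightarrow> real^'n \<Rightarrow> ('m::finite \<Rightarrow> real^'n) \<Rightarrow> real^'m"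
  where "delta_c f x0 x = (\<chi> i. (f (x0 + (x i - x0)) - f (x0 - (x i - x0))) / 2)"

definition centred_simplex_gradient ::
    "(real^'n \<Rightarrow> real) \<Rightarrow> real^'n \<Rightarrow> ('m::finite \<Rightarrow> real^'n) \<Rightarrow> real^'n"
  where "centred_simplex_gradient f x0 x = pinv (transpose (Smat x0 x)) *v delta_c f x0 x"

definition centred_simplex_calculus_gradient_pow ::
    "(real^'n \<Rightarrow> real) \<Rightarrow> real \<Rightarrow> real^'n \<Rightarrow> ('m::finite \<Rightarrow> real^'n) \<Rightarrow> real^'n"
  where "centred_simplex_calculus_gradient_pow f k x0 x =
    (k * rpow (f x0) (k - 1)) *\<^sub>R centred_simplex_gradient f x0 x"

end

theory Submission
  imports Defs
begin

text \<open>
  Both vectors in the estimate carry the same scalar factor \<open>k f(x0)\<^sup>k\<^sup>-\<^sup>1\<close>. In the calculus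
  gradient this is the definition; in the gradient of \<open>(f\<^sup>k)\<^sub>U\<close> it is the chain rule, which yields
  the orthogonal projection of \<open>k f(x0)\<^sup>k\<^sup>-\<^sup>1 \<nabla>f(x0)\<close> onto \<open>U\<close> because the inner map
  \<open>y \<mapsto> x0 + Proj (y - x0)\<close> has the self-adjoint derivative \<open>Proj\<close> (\<open>gderiv_restr_to\<close>). The real
  power satisfies the usual rule at every base where it is needed, including negative bases with
  odd-denominator exponents and the base \<open>0\<close> with \<open>k \<ge> 1\<close> (\<open>has_real_derivative_rpow\<close>).
  So only the centred simplex gradient of \<open>f\<close> has to be compared with the projection of \<open>\<nabla>f(x0)\<close>.

  For the pseudoinverse of \<open>A = S\<^sup>T\<close>, the matrix \<open>A\<^sup>\<dagger>A\<close> is the orthogonal projection onto the row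
  space of \<open>A\<close>, which is \<open>U\<close> (\<open>pinv_mult_eq_orth_proj\<close>). Hence the projection of \<open>\<nabla>f(x0)\<close> is
  \<open>A\<^sup>\<dagger>(A \<nabla>f(x0))\<close>, and the difference of the two gradients is \<open>A\<^sup>\<dagger>\<close> applied to the vector of errors
  \<open>(f(x0 + d) - f(x0 - d)) / 2 - d \<bullet> \<nabla>f(x0)\<close>. The even Taylor terms cancel in such an error, and the
  Lipschitz bound on the Hessian leaves at most \<open>L |d|\<^sup>3 / 6\<close> (\<open>centred_difference_error\<close>). With \<open>m\<close>
  entries and \<open>|d| \<le> \<Delta>\<close>, the error vector has norm at most \<open>\<surd>m L \<Delta>\<^sup>3 / 6\<close>; scaling \<open>S\<close> by
  \<open>1/\<Delta>\<close> multiplies the norm of the pseudoinverse by \<open>\<Delta>\<close>, which absorbs one of the three factors.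
\<close>

section \<open>Orthogonal projections\<close>

lemma orth_proj_eqI:
  assumes "subspace U" "p \<in> U" "\<And>u. u \<in> U \<Longrightarrow> inner (v - p) u = 0"
  shows "orth_proj U v = p"
  unfolding orth_proj_def
proof (rule the_equality)
  show "p \<in> U \<and> (\<forall>u\<in>U. inner (v - p) u = 0)" using assms by blast
next
  fix q assume q: "q \<in> U \<and> (\<forall>u\<in>U. inner (v - q) u = 0)"
  then have "q - p \<in> U" using assms(1,2) by (simp add: subspace_diff)
  then have "inner (v - p) (q - p) - inner (v - q) (q - p) = 0" using assms(3) q by simp
  then have "inner (q - p) (q - p) = 0" by (simp add: inner_diff_left)
  then show "q = p" by simp
qed

lemma
  fixes U :: "'a::euclidean_space set"
  assumes "subspace U"
  shows orth_proj_in: "orth_proj U v \<in> U"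
    and orth_proj_residual: "u \<in> U \<Longrightarrow> inner (v - orth_proj U v) u = 0"
proof -
  obtain y z where "y \<in> span U" and z: "\<And>w. w \<in> span U \<Longrightarrow> orthogonal z w" and v: "v = y + z"
    using orthogonal_subspace_decomp_exists[of U v] by metis
  then have y: "y \<in> U" using assms by (simp add: span_eq_iff[THEN iffD2])
  have z': "inner (v - y) w = 0" if "w \<in> U" for w
    using z[OF span_base[OF that]] v by (simp add: orthogonal_def)
  have "orth_proj U v = y" by (rule orth_proj_eqI[OF assms y z'])
  then show "orth_proj U v \<in> U" "u \<in> U \<Longrightarrow> inner (v - orth_proj U v) u = 0"
    using y z' by simp_all
qed

lemma orth_proj_id:
  assumes "subspace U" "v \<in> U"
  shows "orth_proj U v = v"
  by (rule orth_proj_eqI) (use assms in auto)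

lemma linear_orth_proj:
  fixes U :: "'a::euclidean_space set"
  assumes U: "subspace U"
  shows "linear (orth_proj U)"
proof (rule linearI)
  fix v w :: 'a and c :: real
  show "orth_proj U (v + w) = orth_proj U v + orth_proj U w"
  proof (rule orth_proj_eqI[OF U])
    fix u assume "u \<in> U"
    then show "inner (v + w - (orth_proj U v + orth_proj U w)) u = 0"
      using orth_proj_residual[OF U, of u v] orth_proj_residual[OF U, of u w]
      by (simp add: algebra_simps)
  qed (simp add: U orth_proj_in subspace_add)
  show "orth_proj U (c *\<^sub>R v) = c *\<^sub>R orth_proj U v"
  proof (rule orth_proj_eqI[OF U])
    fix u assume "u \<in> U"
    then show "inner (c *\<^sub>R v - c *\<^sub>R orth_proj U v) u = 0"
      using orth_proj_residual[OF U, of u v] by (simp add: algebra_simps)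
  qed (simp add: U orth_proj_in subspace_scale)
qed

lemma orth_proj_self_adjoint:
  fixes U :: "'a::euclidean_space set"
  assumes U: "subspace U"
  shows "inner (orth_proj U v) w = inner v (orth_proj U w)"
proof -
  have "inner (orth_proj U v) (w - orth_proj U w) = 0" "inner (v - orth_proj U v) (orth_proj U w) = 0"
    using orth_proj_residual[OF U orth_proj_in[OF U]] by (simp_all add: inner_commute)
  then show ?thesis by (simp add: algebra_simps)
qed

section \<open>The Moore--Penrose pseudoinverse\<close>

lemma symmetric_matrixI:
  fixes A :: "real^'n^'n"
  assumes "\<And>v w. inner (A *v v) w = inner v (A *v w)"
  shows "transpose A = A"
  using adjoint_matrix[of A] adjoint_unique[of "(*v) A" "(*v) A"] assms
  by (metis matrix_eq)

text \<open>
  The symmetric products are the orthogonal projections onto range and row space, so they agree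
  for \<open>B\<close> and \<open>C\<close>; and \<open>B = B(AB)\<close> can be rebuilt from the two products.
\<close>
lemma penrose_unique:
  fixes A :: "real^'n^'m" and B C :: "real^'m^'n"
  assumes B: "A ** B ** A = A" "B ** A ** B = B"
      "transpose (A ** B) = A ** B" "transpose (B ** A) = B ** A"
    and C: "A ** C ** A = A" "C ** A ** C = C"
      "transpose (A ** C) = A ** C" "transpose (C ** A) = C ** A"
  shows "B = C"
proof -
  have "A ** B = transpose ((A ** C) ** (A ** B))"
    using B(3) C(1) by (simp add: matrix_mul_assoc)
  also have "\<dots> = (A ** B) ** (A ** C)"
    by (simp only: matrix_transpose_mul[of "A ** C"] B(3) C(3))
  also have "\<dots> = A ** C" using B(1) by (simp add: matrix_mul_assoc)
  finally have AB: "A ** B = A ** C" .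
  have "B ** A = transpose ((B ** A) ** (C ** A))"
    using B(4) C(1) by (metis matrix_mul_assoc)
  also have "\<dots> = (C ** A) ** (B ** A)"
    by (simp only: matrix_transpose_mul[of "B ** A"] B(4) C(4))
  also have "\<dots> = C ** A" using B(1) by (metis matrix_mul_assoc)
  finally have BA: "B ** A = C ** A" .
  have "B = B ** (A ** B)" using B(2) by (simp add: matrix_mul_assoc)
  also have "\<dots> = C ** A ** C" using AB BA by (simp add: matrix_mul_assoc)
  finally show ?thesis using C(2) by simp
qed

text \<open>
  Take any linear right inverse \<open>g\<close> of \<open>A\<close> on the range of \<open>A\<close> and correct it by orthogonal
  projections on both sides: onto the range before \<open>g\<close>, and onto the complement of the kernel
  after it. Then \<open>AB\<close> and \<open>BA\<close> become exactly these two projections.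
\<close>
lemma penrose_exists:
  fixes A :: "real^'n^'m"
  shows "\<exists>B. A ** B ** A = A \<and> B ** A ** B = B \<and>
    transpose (A ** B) = A ** B \<and> transpose (B ** A) = B ** A"
proof -
  define N where "N = {v. A *v v = 0}"
  define R where "R = range ((*v) A)"
  have N: "subspace N" unfolding N_def by (intro linear_subspace_kernel) simp
  have R: "subspace R" unfolding R_def by (intro linear_subspace_image) simp_all
  obtain g where g: "linear g" "\<And>v. A *v g (A *v v) = A *v v"
    using linear_exists_right_inverse_on[of "(*v) A" UNIV] by auto
  define q where "q v = v - orth_proj N v" for v
  have lin: "linear q" "linear (orth_proj R)"
    using linear_orth_proj[OF N] linear_orth_proj[OF R] unfolding q_def
    by (auto intro: linear_compose_sub linear_ident)
  define B where "B = matrix (\<lambda>w. q (g (orth_proj R w)))"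
  have Bv: "B *v w = q (g (orth_proj R w))" for w
    unfolding B_def using lin g(1)
    using linear_compose[OF linear_compose[OF lin(2) g(1)] lin(1)]
    by (intro matrix_works) (simp add: linear_matrix_vector_mul_eq o_def)
  have Aq: "A *v q v = A *v v" for v
    using orth_proj_in[OF N, of v] by (simp add: q_def N_def matrix_vector_mult_diff_distrib)
  have q_proj: "q (g (A *v v)) = q v" for v
  proof -
    have "g (A *v v) - v \<in> N" by (simp add: N_def matrix_vector_mult_diff_distrib g(2))
    then have "q (g (A *v v) - v) = 0" by (simp add: q_def orth_proj_id[OF N])
    then show ?thesis using linear_diff[OF lin(1)] by simp
  qed
  have PA: "orth_proj R (A *v v) = A *v v" for v
    by (rule orth_proj_id[OF R]) (simp add: R_def)
  have AB: "(A ** B) *v w = orth_proj R w" for w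
  proof -
    obtain u where "orth_proj R w = A *v u" using orth_proj_in[OF R, of w] R_def by auto
    then show ?thesis by (simp add: matrix_vector_mul_assoc[symmetric] Bv Aq g(2))
  qed
  have BA: "(B ** A) *v v = q v" for v
    by (simp add: matrix_vector_mul_assoc[symmetric] Bv PA q_proj)
  have "A ** B ** A = A"
    by (simp only: matrix_eq matrix_vector_mul_assoc[symmetric, of "A ** B"] AB PA) simp
  moreover have "B ** A ** B = B"
    unfolding matrix_eq matrix_vector_mul_assoc[symmetric, of "B ** A"] BA Bv
    by (simp add: q_def orth_proj_id[OF N orth_proj_in[OF N]] linear_diff[OF linear_orth_proj[OF N]])
  moreover have "transpose (A ** B) = A ** B"
    by (rule symmetric_matrixI) (simp only: AB orth_proj_self_adjoint[OF R])
  moreover have "transpose (B ** A) = B ** A"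
    by (rule symmetric_matrixI)
      (simp only: BA q_def inner_diff_left inner_diff_right orth_proj_self_adjoint[OF N])
  ultimately show ?thesis by blast
qed

lemma pinv_eqI:
  fixes A :: "real^'n^'m"
  assumes "A ** B ** A = A" "B ** A ** B = B"
    "transpose (A ** B) = A ** B" "transpose (B ** A) = B ** A"
  shows "pinv A = B"
  unfolding pinv_def
  by (rule the_equality) (use assms in \<open>blast intro: penrose_unique\<close>)+

lemma
  fixes A :: "real^'n^'m"
  shows pinv_inner_inverse: "A ** pinv A ** A = A"
    and pinv_outer_inverse: "pinv A ** A ** pinv A = pinv A"
    and transpose_mult_pinv: "transpose (A ** pinv A) = A ** pinv A"
    and transpose_pinv_mult: "transpose (pinv A ** A) = pinv A ** A"
  using penrose_exists[of A] pinv_eqI[of A] by metis+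

lemma pinv_scaleR:
  fixes A :: "real^'n^'m"
  assumes "c \<noteq> 0"
  shows "pinv (c *\<^sub>R A) = (1 / c) *\<^sub>R pinv A"
  using assms
  by (intro pinv_eqI)
    (simp_all add: scalar_matrix_assoc[symmetric] matrix_scalar_ac transpose_scalar pinv_inner_inverse pinv_outer_inverse
      transpose_mult_pinv transpose_pinv_mult)

text \<open>
  Symmetry of \<open>A\<^sup>\<dagger>A\<close> puts its range into the range of \<open>A\<^sup>T\<close>, the row space, and \<open>AA\<^sup>\<dagger>A = A\<close> says
  that \<open>v - A\<^sup>\<dagger>Av\<close> is killed by \<open>A\<close>, that is, orthogonal to every row.
\<close>
lemma pinv_mult_eq_orth_proj:
  fixes A :: "real^'n^'m"
  shows "pinv A *v (A *v v) = orth_proj (span (rows A)) v"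
proof (rule orth_proj_eqI[symmetric])
  have "pinv A *v (A *v v) = transpose A *v (transpose (pinv A) *v v)"
    by (metis matrix_transpose_mul matrix_vector_mul_assoc transpose_pinv_mult)
  then show "pinv A *v (A *v v) \<in> span (rows A)"
    using matrix_vector_mult_in_columnspace[of "transpose A"] by (metis columns_transpose)
next
  have "A *v (v - pinv A *v (A *v v)) = 0"
    by (metis matrix_vector_mul_assoc matrix_vector_mult_diff_distrib pinv_inner_inverse cancel_comm_monoid_add_class.diff_cancel)
  then have "inner (row i A) (v - pinv A *v (A *v v)) = 0" for i
    using matrix_vector_mul_component[of A] by (metis row_def vec_nth_inverse zero_index)
  then have "orthogonal (v - pinv A *v (A *v v)) w" if "w \<in> rows A" for w
    using that by (auto simp: rows_def orthogonal_def inner_commute)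
  then show "inner (v - pinv A *v (A *v v)) u = 0" if "u \<in> span (rows A)" for u
    using orthogonal_to_span[OF that] by (metis orthogonal_def)
qed simp

section \<open>Real powers\<close>

lemma abs_rpow: "\<bar>rpow x a\<bar> = rpow \<bar>x\<bar> a"
  by (auto simp: rpow_def)

lemma rpow_one: "rpow x 1 = x"
  using rpow_odd_root[of 1 x] by simp

text \<open>
  On each side of \<open>0\<close>, \<open>rpow\<close> is locally a constant sign times \<open>\<bar>x\<bar> powr k\<close>. For \<open>t < 0\<close> and
  \<open>k = p/q\<close> the exponent \<open>k - 1 = (p - q)/q\<close> has a numerator of the opposite parity, and this sign
  change is the one produced by differentiating \<open>- x\<close>. At \<open>t = 0\<close> the function is the identity for
  \<open>k = 1\<close> (where \<open>rpow 0 0 = 1\<close> is the right value) and \<open>o(\<bar>x\<bar>)\<close> for \<open>k > 1\<close>; the latter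
  bound holds for whatever signs \<open>rpow\<close> takes on the negative axis.
\<close>
lemma has_real_derivative_rpow:
  assumes dom: "rpow_defined t k" and nonzero: "k - 1 < 0 \<Longrightarrow> t \<noteq> 0"
  shows "((\<lambda>x. rpow x k) has_real_derivative k * rpow t (k - 1)) (at t)"
proof -
  consider "t > 0" | "t < 0" | "t = 0" "k = 1" | "t = 0" "k > 1"
    using nonzero by fastforce
  then show ?thesis
  proof cases
    case 1
    have "((\<lambda>x. x powr k) has_real_derivative k * rpow t (k - 1)) (at t)"
      using has_real_derivative_powr[OF 1, of k] 1 by (simp add: rpow_def)
    moreover have "\<forall>\<^sub>F x in nhds t. x \<in> {0<..}"
      using 1 by (intro eventually_nhds_in_open) auto
    then have "\<forall>\<^sub>F x in nhds t. x powr k = rpow x k"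
      by eventually_elim (simp add: rpow_def)
    ultimately show ?thesis by (simp add: DERIV_cong_ev)
  next
    case 2
    then obtain p q :: int where pq: "odd q" "k = of_int p / of_int q"
      using dom by (auto simp: rpow_defined_def)
    then have "q \<noteq> 0" by auto
    then have k1: "k - 1 = of_int (p - q) / of_int q" by (simp add: pq(2) field_simps)
    define s :: real where "s = (if even p then 1 else -1)"
    have "rpow t (k - 1) = - s * (- t) powr (k - 1)"
      unfolding k1 using rpow_neg_ratio[OF 2 pq(1), of "p - q"] 2 pq(1) by (simp add: s_def)
    moreover have "((\<lambda>x. s * (- x) powr k) has_real_derivative s * (k * (- t) powr (k - 1) * (- 1))) (at t)"
      using 2 by (intro DERIV_cmult DERIV_chain2[OF has_real_derivative_powr]) (auto intro!: derivative_eq_intros)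
    ultimately have *: "((\<lambda>x. s * (- x) powr k) has_real_derivative k * rpow t (k - 1)) (at t)"
      by (simp add: mult_ac)
    have ev: "\<forall>\<^sub>F x in nhds t. x \<in> {..<0}"
      using 2 by (intro eventually_nhds_in_open) auto
    have "\<forall>\<^sub>F x in nhds t. s * (- x) powr k = rpow x k"
      using ev by eventually_elim (simp add: pq(2) rpow_neg_ratio[OF _ pq(1)] s_def)
    then show ?thesis using * by (simp add: DERIV_cong_ev)
  next
    case 3
    have "rpow 0 0 = 1" by (simp add: rpow_def)
    then show ?thesis using 3 by (simp add: rpow_one)
  next
    case 4
    have "((\<lambda>h. (rpow h k - rpow 0 k) / h) \<longlongrightarrow> 0) (at 0)"
    proof (rule Lim_null_comparison)
      show "((\<lambda>h. \<bar>h\<bar> powr (k - 1)) \<longlongrightarrow> 0) (at (0::real))"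
        using 4 by (intro tendsto_zero_powrI[where b = "k - 1"] tendsto_eq_intros) auto
      have "norm ((rpow h k - rpow 0 k) / h) \<le> \<bar>h\<bar> powr (k - 1)" if "h \<noteq> 0" for h
      proof -
        have "\<bar>rpow h k\<bar> = \<bar>h\<bar> powr k" using that by (simp add: abs_rpow) (simp add: rpow_def)
        moreover have "rpow 0 k = 0" using 4 by (simp add: rpow_def)
        ultimately show ?thesis using that by (simp add: powr_diff)
      qed
      then show "\<forall>\<^sub>F h in at 0. norm ((rpow h k - rpow 0 k) / h) \<le> \<bar>h\<bar> powr (k - 1)"
        by (simp add: eventually_at_filter)
    qed
    moreover have "rpow 0 (k - 1) = 0" using 4 by (simp add: rpow_def)
    ultimately show ?thesis using 4 by (simp add: DERIV_def)
  qed
qed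

section \<open>Gradients and Hessians\<close>

lemma gderiv_sum_Basis:
  fixes f :: "'a::euclidean_space \<Rightarrow> real"
  assumes "f differentiable (at y)"
  shows "GDERIV f y :> (\<Sum>b\<in>Basis. frechet_derivative f (at y) b *\<^sub>R b)"
proof -
  let ?F = "frechet_derivative f (at y)"
  have F: "(f has_derivative ?F) (at y)" using assms frechet_derivative_works by blast
  then interpret linear ?F by (rule has_derivative_linear)
  have "?F h = inner h (\<Sum>b\<in>Basis. ?F b *\<^sub>R b)" for h
  proof -
    have "?F h = ?F (\<Sum>b\<in>Basis. inner h b *\<^sub>R b)" by (simp add: euclidean_representation)
    also have "\<dots> = (\<Sum>b\<in>Basis. inner h b * ?F b)" by (simp add: sum scale)
    finally show ?thesis by (simp add: inner_sum_right mult.commute)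
  qed
  then have "?F = (\<lambda>h. inner h (\<Sum>b\<in>Basis. ?F b *\<^sub>R b))" by (rule ext)
  then show ?thesis unfolding gderiv_def using F by metis
qed

lemma gderiv_gradient:
  fixes f :: "'a::euclidean_space \<Rightarrow> real"
  assumes "f differentiable (at y)"
  shows "GDERIV f y :> gradient f y"
  using gderiv_sum_Basis[OF assms] gradient_eq by metis

text \<open>
  The definition of \<open>hessian\<close> gives no information unless \<open>gradient f\<close> is differentiable.
  This follows from the differentiability of the partial derivatives,
  since near \<open>y\<close> the gradient is their finite sum over the basis.
\<close>
lemma gradient_has_derivative_hessian:
  fixes f :: "real^'n \<Rightarrow> real"
  assumes "open U" "y \<in> U" and f: "\<And>z. z \<in> U \<Longrightarrow> f differentiable (at z)"
    and f': "\<And>v. (\<lambda>z. frechet_derivative f (at z) v) differentiable (at y)"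
  shows "(gradient f has_derivative (\<lambda>h. hessian f y *v h)) (at y)"
proof -
  have "(\<lambda>z. \<Sum>b\<in>Basis. frechet_derivative f (at z) b *\<^sub>R b) differentiable (at y)"
    using f' by (intro differentiable_sum differentiable_scaleR) auto
  then obtain G where
    "((\<lambda>z. \<Sum>b\<in>Basis. frechet_derivative f (at z) b *\<^sub>R b) has_derivative G) (at y)"
    unfolding differentiable_def by blast
  then have "(gradient f has_derivative G) (at y)"
    by (rule has_derivative_transform_within_open[OF _ assms(1,2)])
      (simp add: gradient_eq[OF gderiv_sum_Basis[OF f]])
  then have D: "(gradient f has_derivative frechet_derivative (gradient f) (at y)) (at y)"
    using frechet_derivative_at by metis
  have "hessian f y *v h = frechet_derivative (gradient f) (at y) h" for h
    unfolding hessian_def using has_derivative_linear[OF D]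
    by (intro matrix_works) (simp add: linear_matrix_vector_mul_eq)
  then show ?thesis using D by simp
qed

lemma gderiv_restr_to:
  fixes h :: "'a::euclidean_space \<Rightarrow> real"
  assumes U: "subspace U" and h: "GDERIV h x0 :> D"
  shows "GDERIV (restr_to U x0 h) x0 :> orth_proj U D"
proof -
  have P: "bounded_linear (orth_proj U)"
    using linear_orth_proj[OF U] by (rule linear_conv_bounded_linear[THEN iffD1])
  have "((\<lambda>y. x0 + orth_proj U (y - x0)) has_derivative orth_proj U) (at x0)"
    by (rule derivative_eq_intros bounded_linear.has_derivative[OF P] refl | simp)+
  moreover have "(h has_derivative (\<lambda>v. inner v D)) (at (x0 + orth_proj U (x0 - x0)))"
    using h linear_0[OF linear_orth_proj[OF U]] by (simp add: gderiv_def)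
  ultimately have "(restr_to U x0 h has_derivative (\<lambda>v. inner (orth_proj U v) D)) (at x0)"
    unfolding restr_to_def by (rule has_derivative_compose)
  then show ?thesis by (simp add: gderiv_def orth_proj_self_adjoint[OF U])
qed

section \<open>The error of the centred difference\<close>

lemma norm_mult_vec_le_opnorm: "norm (A *v v) \<le> opnorm A * norm v"
  unfolding opnorm_def by (rule onorm) simp

lemma opnorm_nonneg: "0 \<le> opnorm A"
  unfolding opnorm_def by (rule onorm_pos_le) simp

lemma opnorm_scaleR: "opnorm (c *\<^sub>R A) = \<bar>c\<bar> * opnorm A"
  unfolding opnorm_def
  using onorm_scaleR[of "(*v) A" c] by (simp add: scaleR_matrix_vector_assoc)

text \<open>Two applications of the mean value inequality, with comparison functions \<open>K t\<^sup>2/2\<close> and \<open>K t\<^sup>3/6\<close>.\<close>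
lemma cubic_bound_from_second_derivative:
  fixes \<phi> :: "real \<Rightarrow> real"
  assumes d1: "\<And>t. t \<in> {0..1} \<Longrightarrow> (\<phi> has_real_derivative \<phi>' t) (at t)"
    and d2: "\<And>t. t \<in> {0..1} \<Longrightarrow> (\<phi>' has_real_derivative \<phi>'' t) (at t)"
    and init: "\<phi> 0 = 0" "\<phi>' 0 = 0"
    and bound: "\<And>t. t \<in> {0..1} \<Longrightarrow> \<bar>\<phi>'' t\<bar> \<le> K * t"
  shows "\<bar>\<phi> 1\<bar> \<le> K / 6"
proof -
  have cont: "continuous_on {0..s} \<phi>" "continuous_on {0..s} \<phi>'" if "s \<le> 1" for s
    using that d1 d2 by (fastforce intro!: continuous_at_imp_continuous_on dest: DERIV_isCont)+
  have "\<bar>\<phi>' s\<bar> \<le> K * s\<^sup>2 / 2" if s: "0 < s" "s \<le> 1" for s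
  proof -
    have "norm (\<phi>' s - \<phi>' 0) \<le> K * s\<^sup>2 / 2 - K * 0\<^sup>2 / 2"
    proof (rule differentiable_bound_general[OF s(1) cont(2)[OF s(2)]])
      show "(\<phi>' has_vector_derivative \<phi>'' t) (at t)" if "0 < t" "t < s" for t
        using d2[of t] that s by (simp add: has_real_derivative_iff_has_vector_derivative)
      show "((\<lambda>t. K * t\<^sup>2 / 2) has_vector_derivative K * t) (at t)" for t
        unfolding has_real_derivative_iff_has_vector_derivative[symmetric]
        by (auto intro!: derivative_eq_intros)
    qed (use bound s in \<open>auto intro!: continuous_intros\<close>)
    then show ?thesis by (simp add: init)
  qed
  have "norm (\<phi> 1 - \<phi> 0) \<le> K * 1 ^ 3 / 6 - K * 0 ^ 3 / 6"
  proof (rule differentiable_bound_general[OF zero_less_one cont(1)[OF order_refl]])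
    show "(\<phi> has_vector_derivative \<phi>' t) (at t)" if "0 < t" "t < 1" for t
      using d1[of t] that by (simp add: has_real_derivative_iff_has_vector_derivative)
    show "((\<lambda>t. K * t ^ 3 / 6) has_vector_derivative K * t\<^sup>2 / 2) (at t)" for t
      unfolding has_real_derivative_iff_has_vector_derivative[symmetric]
      by (auto intro!: derivative_eq_intros simp: power2_eq_square)
  qed (use \<open>\<And>s. 0 < s \<Longrightarrow> s \<le> 1 \<Longrightarrow> \<bar>\<phi>' s\<bar> \<le> K * s\<^sup>2 / 2\<close> in \<open>auto intro!: continuous_intros\<close>)
  then show ?thesis by (simp add: init)
qed

text \<open>
  Along the line \<open>t \<mapsto> x0 + t d\<close> the second derivative of the error is half the difference of the
  quadratic forms of the Hessians at \<open>x0 + t d\<close> and \<open>x0 - t d\<close>. These points are \<open>2 t |d|\<close>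
  apart, so it is at most \<open>L |d|\<^sup>3 t\<close>, while the error and its first derivative vanish at \<open>t = 0\<close>.
\<close>
lemma centred_difference_error:
  fixes f :: "real^'n \<Rightarrow> real"
  assumes f: "\<And>y. y \<in> ball x0 r \<Longrightarrow> f differentiable (at y)"
    and f': "\<And>v y. y \<in> ball x0 r \<Longrightarrow> (\<lambda>z. frechet_derivative f (at z) v) differentiable (at y)"
    and lipschitz: "\<And>y z. y \<in> ball x0 r \<Longrightarrow> z \<in> ball x0 r \<Longrightarrow>
          opnorm (hessian f y - hessian f z) \<le> L * norm (y - z)"
    and d: "norm d < r"
  shows "\<bar>(f (x0 + d) - f (x0 - d)) / 2 - inner d (gradient f x0)\<bar> \<le> L * norm d ^ 3 / 6"
proof -
  define \<phi> where "\<phi> t = (f (x0 + t *\<^sub>R d) - f (x0 - t *\<^sub>R d)) / 2 - t * inner d (gradient f x0)" for t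
  define \<phi>' where "\<phi>' t = (inner d (gradient f (x0 + t *\<^sub>R d))
      + inner d (gradient f (x0 - t *\<^sub>R d))) / 2 - inner d (gradient f x0)" for t
  define \<phi>'' where "\<phi>'' t = (inner d (hessian f (x0 + t *\<^sub>R d) *v d)
      - inner d (hessian f (x0 - t *\<^sub>R d) *v d)) / 2" for t
  have in_ball: "x0 + t *\<^sub>R d \<in> ball x0 r" "x0 - t *\<^sub>R d \<in> ball x0 r" if "t \<in> {0..1}" for t
  proof -
    have "\<bar>t\<bar> * norm d \<le> 1 * norm d" using that by (intro mult_right_mono) auto
    then show "x0 + t *\<^sub>R d \<in> ball x0 r" "x0 - t *\<^sub>R d \<in> ball x0 r"
      using d by (simp_all add: dist_norm)
  qed
  have Df: "(f has_derivative (\<lambda>h. inner h (gradient f y))) (at y)" if "y \<in> ball x0 r" for y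
    using gderiv_gradient[OF f[OF that]] by (simp add: gderiv_def)
  have Dg: "(gradient f has_derivative (\<lambda>h. hessian f y *v h)) (at y)" if "y \<in> ball x0 r" for y
    by (rule gradient_has_derivative_hessian[OF open_ball that f f'[OF that]])
  have plus: "((\<lambda>t. x0 + t *\<^sub>R d) has_derivative (\<lambda>s. s *\<^sub>R d)) (at t)" for t
    by (auto intro!: derivative_eq_intros)
  have minus: "((\<lambda>t. x0 - t *\<^sub>R d) has_derivative (\<lambda>s. - (s *\<^sub>R d))) (at t)" for t
    by (auto intro!: derivative_eq_intros)
  have "\<bar>\<phi> 1\<bar> \<le> (L * norm d ^ 3) / 6"
  proof (rule cubic_bound_from_second_derivative)
    show "\<phi> 0 = 0" "\<phi>' 0 = 0" by (simp_all add: \<phi>_def \<phi>'_def)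
  next
    fix t :: real assume t: "t \<in> {0..1}"
    have Df_line: "((\<lambda>s. f (x0 + s *\<^sub>R d)) has_real_derivative
          inner d (gradient f (x0 + t *\<^sub>R d))) (at t)"
        "((\<lambda>s. f (x0 - s *\<^sub>R d)) has_real_derivative
          - inner d (gradient f (x0 - t *\<^sub>R d))) (at t)"
      using has_derivative_compose[OF plus Df[OF in_ball(1)[OF t]]]
        has_derivative_compose[OF minus Df[OF in_ball(2)[OF t]]]
      by (auto elim!: has_derivative_imp_has_field_derivative)
    show "(\<phi> has_real_derivative \<phi>' t) (at t)"
      unfolding \<phi>_def \<phi>'_def by (rule derivative_eq_intros Df_line refl | simp)+
    have "((\<lambda>s. inner d (gradient f (x0 + s *\<^sub>R d))) has_derivative
          (\<lambda>s. inner d (hessian f (x0 + t *\<^sub>R d) *v (s *\<^sub>R d)))) (at t)"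
        "((\<lambda>s. inner d (gradient f (x0 - s *\<^sub>R d))) has_derivative
          (\<lambda>s. inner d (hessian f (x0 - t *\<^sub>R d) *v (- (s *\<^sub>R d))))) (at t)"
      by (intro has_derivative_inner_right has_derivative_compose[OF plus Dg[OF in_ball(1)[OF t]]]
          has_derivative_compose[OF minus Dg[OF in_ball(2)[OF t]]])+
    then have Dg_line: "((\<lambda>s. inner d (gradient f (x0 + s *\<^sub>R d))) has_real_derivative
          inner d (hessian f (x0 + t *\<^sub>R d) *v d)) (at t)"
        "((\<lambda>s. inner d (gradient f (x0 - s *\<^sub>R d))) has_real_derivative
          - inner d (hessian f (x0 - t *\<^sub>R d) *v d)) (at t)"
      by (auto elim!: has_derivative_imp_has_field_derivative
          simp: scaleR_minus_left[symmetric] matrix_vector_mult_scaleR simp del: scaleR_minus_left)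
    show "(\<phi>' has_real_derivative \<phi>'' t) (at t)"
      unfolding \<phi>'_def \<phi>''_def by (rule derivative_eq_intros Dg_line refl | simp)+
    let ?H = "hessian f (x0 + t *\<^sub>R d) - hessian f (x0 - t *\<^sub>R d)"
    have "opnorm ?H \<le> L * norm ((x0 + t *\<^sub>R d) - (x0 - t *\<^sub>R d))"
      by (rule lipschitz[OF in_ball[OF t]])
    also have "(x0 + t *\<^sub>R d) - (x0 - t *\<^sub>R d) = (2 * t) *\<^sub>R d"
      by (simp add: algebra_simps scaleR_2[symmetric])
    finally have H: "opnorm ?H \<le> L * (2 * t * norm d)" using t by simp
    have "\<bar>inner d (?H *v d)\<bar> \<le> norm d * norm (?H *v d)" by (rule Cauchy_Schwarz_ineq2)
    also have "\<dots> \<le> norm d * (opnorm ?H * norm d)"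
      by (intro mult_left_mono norm_mult_vec_le_opnorm) simp
    also have "\<dots> \<le> norm d * (L * (2 * t * norm d) * norm d)"
      by (intro mult_left_mono mult_right_mono H) simp_all
    finally have "\<bar>inner d (?H *v d)\<bar> \<le> norm d * (L * (2 * t * norm d) * norm d)" .
    moreover have "\<phi>'' t = inner d (?H *v d) / 2"
      by (simp add: \<phi>''_def matrix_vector_mult_diff_rdistrib inner_diff_right)
    ultimately show "\<bar>\<phi>'' t\<bar> \<le> L * norm d ^ 3 * t"
      by (simp add: power3_eq_cube mult_ac)
  qed
  then show ?thesis by (simp add: \<phi>_def)
qed

lemma norm_vec_le_sqrt_card:
  fixes v :: "real^'m"
  assumes "\<And>i. \<bar>v $ i\<bar> \<le> c"
  shows "norm v \<le> sqrt (real CARD('m)) * c"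
proof -
  have "0 \<le> c" using assms[of undefined] by linarith
  have "norm v \<le> norm (\<chi> i::'m. c)"
    using assms \<open>0 \<le> c\<close> by (intro norm_le_componentwise_cart) simp
  also have "\<dots> = sqrt (real CARD('m)) * c"
    using \<open>0 \<le> c\<close> by (simp add: norm_vec_def L2_set_def real_sqrt_mult)
  finally show ?thesis .
qed

lemma centred_simplex_gradient_error:
  fixes f :: "real^'n \<Rightarrow> real" and x :: "'m::finite \<Rightarrow> real^'n"
  assumes "\<And>y. y \<in> ball x0 r \<Longrightarrow> f differentiable (at y)"
    and "\<And>v y. y \<in> ball x0 r \<Longrightarrow> (\<lambda>z. frechet_derivative f (at z) v) differentiable (at y)"
    and "\<And>y z. y \<in> ball x0 r \<Longrightarrow> z \<in> ball x0 r \<Longrightarrow>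
          opnorm (hessian f y - hessian f z) \<le> L * norm (y - z)"
    and L: "0 \<le> L" and r: "radius x0 x < r"
  shows "norm (centred_simplex_gradient f x0 x
      - orth_proj (span (columns (Smat x0 x))) (gradient f x0))
    \<le> opnorm (pinv (transpose (Smat x0 x))) * (sqrt (real CARD('m)) * (L * radius x0 x ^ 3 / 6))"
proof -
  let ?A = "transpose (Smat x0 x)" and ?g = "gradient f x0"
  have "orth_proj (span (columns (Smat x0 x))) ?g = pinv ?A *v (?A *v ?g)"
    by (simp only: pinv_mult_eq_orth_proj rows_transpose)
  then have error: "centred_simplex_gradient f x0 x - orth_proj (span (columns (Smat x0 x))) ?g
      = pinv ?A *v (delta_c f x0 x - ?A *v ?g)"
    by (simp only: centred_simplex_gradient_def matrix_vector_mult_diff_distrib)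
  have bound: "norm (delta_c f x0 x - ?A *v ?g) \<le> sqrt (real CARD('m)) * (L * radius x0 x ^ 3 / 6)"
  proof (rule norm_vec_le_sqrt_card)
    fix i
    have le: "norm (x i - x0) \<le> radius x0 x" by (simp add: radius_def)
    have "(?A *v ?g) $ i = inner (x i - x0) ?g"
      by (simp add: matrix_vector_mul_component transpose_def Smat_def del: transpose_matrix_vector)
         (simp add: inner_vec_def)
    then have "(delta_c f x0 x - ?A *v ?g) $ i
        = (f (x0 + (x i - x0)) - f (x0 - (x i - x0))) / 2 - inner (x i - x0) ?g"
      by (simp only: delta_c_def vector_minus_component vec_lambda_beta)
    moreover have "\<bar>(f (x0 + (x i - x0)) - f (x0 - (x i - x0))) / 2 - inner (x i - x0) ?g\<bar>
        \<le> L * norm (x i - x0) ^ 3 / 6"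
      using le r by (intro centred_difference_error[where r = r, OF assms(1-3)]) simp_all
    ultimately have "\<bar>(delta_c f x0 x - ?A *v ?g) $ i\<bar> \<le> L * norm (x i - x0) ^ 3 / 6"
      by simp
    also have "\<dots> \<le> L * radius x0 x ^ 3 / 6"
      using L le by (intro divide_right_mono mult_left_mono power_mono) auto
    finally show "\<bar>(delta_c f x0 x - ?A *v ?g) $ i\<bar> \<le> L * radius x0 x ^ 3 / 6" .
  qed
  show ?thesis
    unfolding error
    by (rule order_trans[OF norm_mult_vec_le_opnorm mult_left_mono[OF bound opnorm_nonneg]])
qed

theorem proposition5p5:
  fixes f :: "real^'n \<Rightarrow> real"
    and x0 :: "real^'n"
    and x :: "'m::finite \<Rightarrow> real^'n"
    and \<Delta>bar L k :: real
  defines "\<Delta> \<equiv> radius x0 x"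
    and "S \<equiv> Smat x0 x"
    and "U \<equiv> span (columns (Smat x0 x))"
  assumes C3: "Ck_on 3 f (ball x0 \<Delta>bar)"
    and lipschitz: "\<And>y z. y \<in> ball x0 \<Delta>bar \<Longrightarrow> z \<in> ball x0 \<Delta>bar \<Longrightarrow>
          opnorm (hessian f y - hessian f z) \<le> L * norm (y - z)"
    and nonzero: "k - 1 < 0 \<Longrightarrow> f x0 \<noteq> 0"
    and power_defined: "\<forall>\<^sub>F y in nhds x0. rpow_defined (restr_to U x0 f y) k"
    and distinct: "inj x" "x0 \<notin> range x"
    and radius: "\<Delta> < \<Delta>bar"
    and full_rank: "rank S = min CARD('m) CARD('n)"
  shows "norm (centred_simplex_calculus_gradient_pow f k x0 x
            - gradient (restr_to U x0 (\<lambda>y. rpow (f y) k)) x0)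
         \<le> L * sqrt (real CARD('m)) / 6 * \<bar>k\<bar> * rpow \<bar>f x0\<bar> (k - 1)
            * opnorm (pinv (transpose ((1 / \<Delta>) *\<^sub>R S))) * \<Delta>\<^sup>2"
proof -
  have U: "subspace U" by (simp add: U_def)
  \<comment> \<open>A point different from \<open>x0\<close> makes the radius positive and, through the Lipschitz condition,
    forces \<open>L \<ge> 0\<close>.\<close>
  obtain i :: 'm where True by simp
  have "norm (x i - x0) > 0" using distinct(2) by auto
  moreover have le: "norm (x i - x0) \<le> \<Delta>" by (simp add: \<Delta>_def radius_def)
  ultimately have \<Delta>: "0 < \<Delta>" by linarith
  have x0: "x0 \<in> ball x0 \<Delta>bar" and xi: "x i \<in> ball x0 \<Delta>bar"
    using \<Delta> le radius by (simp_all add: dist_norm norm_minus_commute)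
  have "0 \<le> L * norm (x i - x0)"
    using lipschitz[OF xi x0] opnorm_nonneg order_trans by blast
  then have L: "0 \<le> L" using \<open>norm (x i - x0) > 0\<close> by (simp add: zero_le_mult_iff)
  have f: "f differentiable (at y)" if "y \<in> ball x0 \<Delta>bar" for y
    using C3 that by (simp add: numeral_3_eq_3)
  have f': "(\<lambda>z. frechet_derivative f (at z) v) differentiable (at y)"
    if "y \<in> ball x0 \<Delta>bar" for v y
    using C3 that by (simp add: numeral_3_eq_3)

  \<comment> \<open>the common scalar factor of the two gradients\<close>
  define c where "c = k * rpow (f x0) (k - 1)"
  have "restr_to U x0 f x0 = f x0"
    using linear_0[OF linear_orth_proj[OF U]] by (simp add: restr_to_def)
  \<comment> \<open>The chain rule uses the domain condition at \<open>f x0\<close>: if \<open>f x0 < 0\<close>, it makes \<open>k\<close> a ratio with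
    odd denominator.\<close>
  then have "rpow_defined (f x0) k"
    using eventually_nhds_x_imp_x[OF power_defined] by simp
  then have "((\<lambda>s. rpow s k) has_real_derivative c) (at (f x0))"
    unfolding c_def using nonzero by (rule has_real_derivative_rpow)
  then have "GDERIV (\<lambda>y. rpow (f y) k) x0 :> c *\<^sub>R gradient f x0"
    using GDERIV_DERIV_compose[OF gderiv_gradient[OF f[OF x0]]] by blast
  then have "gradient (restr_to U x0 (\<lambda>y. rpow (f y) k)) x0 = orth_proj U (c *\<^sub>R gradient f x0)"
    by (intro gradient_eq gderiv_restr_to[OF U])
  also have "\<dots> = c *\<^sub>R orth_proj U (gradient f x0)"
    by (rule linear_scale[OF linear_orth_proj[OF U]])
  finally have grad: "gradient (restr_to U x0 (\<lambda>y. rpow (f y) k)) x0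
      = c *\<^sub>R orth_proj U (gradient f x0)" .

  have "norm (centred_simplex_calculus_gradient_pow f k x0 x
            - gradient (restr_to U x0 (\<lambda>y. rpow (f y) k)) x0)
      = \<bar>c\<bar> * norm (centred_simplex_gradient f x0 x - orth_proj U (gradient f x0))"
    by (simp add: grad centred_simplex_calculus_gradient_pow_def c_def[symmetric]
        scaleR_diff_right[symmetric])
  also have "\<dots> \<le> \<bar>c\<bar> * (opnorm (pinv (transpose S)) * (sqrt (real CARD('m)) * (L * \<Delta> ^ 3 / 6)))"
    unfolding U_def \<Delta>_def S_def using radius
    by (intro mult_left_mono centred_simplex_gradient_error[where r = \<Delta>bar, OF f f' lipschitz L])
      (simp_all add: \<Delta>_def)
  also have "\<bar>c\<bar> = \<bar>k\<bar> * rpow \<bar>f x0\<bar> (k - 1)" by (simp add: c_def abs_mult abs_rpow)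
  also have "opnorm (pinv (transpose S)) = opnorm (pinv (transpose ((1 / \<Delta>) *\<^sub>R S))) / \<Delta>"
    using \<Delta> by (simp add: transpose_scalar pinv_scaleR opnorm_scaleR)
  also have "\<bar>k\<bar> * rpow \<bar>f x0\<bar> (k - 1)
        * (opnorm (pinv (transpose ((1 / \<Delta>) *\<^sub>R S))) / \<Delta> * (sqrt (real CARD('m)) * (L * \<Delta> ^ 3 / 6)))
      = L * sqrt (real CARD('m)) / 6 * \<bar>k\<bar> * rpow \<bar>f x0\<bar> (k - 1)
        * opnorm (pinv (transpose ((1 / \<Delta>) *\<^sub>R S))) * \<Delta>\<^sup>2"
    using \<Delta> by (simp add: power2_eq_square power3_eq_cube)
  finally show ?thesis .
qed

end
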